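(* Let $X$ and $Y$ be Banach spaces and let $Z=X\oplus_\infty Y$. Then $Z$ has $BDP$ if and only if both $X$ and $Y$ have $BDP$.
   Context: All Banach spaces are real and nontrivial. For a Banach space $E$, $B_E$ is the closed unit ball and $S_E$ the unit sphere. A slice of $B_E$ is a set $S(B_E,x^*,\alpha)=\{x\in B_E: x^*(x)>1-\alpha\}$ with $x^*\in S_{E^*}$ and $\alpha>0$. $E$ has the Ball Dentable Property ($BDP$) if for every $\varepsilon>0$ there is a slice of $B_E$ with diameter less than $\varepsilon$. $X\oplus_\infty Y$ is $X\times Y$ with norm $\|(x,y)\|=\max\{\|x\|,\|y\|\}$. *)

theory Defs
  imports "HOL-Analysis.Analysis"
begin

section \<open>Ball dentability\<close>

text \<open>The dual of \<open>E\<close> is the space \<open>E \<Rightarrow>\<^sub>L real\<close> of bounded linear functionals with the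
  operator norm. \<open>BDP\<close> only uses \<open>ball_slice f \<alpha>\<close> for \<open>f\<close> in the dual unit sphere and
  \<open>\<alpha> > 0\<close>.\<close>

definition ball_slice :: "('a::real_normed_vector \<Rightarrow>\<^sub>L real) \<Rightarrow> real \<Rightarrow> 'a set" where
  "ball_slice f \<alpha> = {x \<in> cball 0 1. blinfun_apply f x > 1 - \<alpha>}"

definition BDP :: "'a::banach itself \<Rightarrow> bool" where
  "BDP (_ :: 'a itself) \<longleftrightarrow>
    (\<forall>\<epsilon>>0. \<exists>f :: 'a \<Rightarrow>\<^sub>L real. \<exists>\<alpha>>0. norm f = 1 \<and> diameter (ball_slice f \<alpha>) < \<epsilon>)"

section \<open>The \<open>\<ell>\<^sub>\<infinity>\<close>-sum of two Banach spaces\<close>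

text \<open>A copy of the product type is needed because the library equips \<open>'a \<times> 'b\<close> with the
  Euclidean combination of the two norms.\<close>

datatype ('a, 'b) linf_sum (infixr \<open>\<oplus>\<^sub>\<infinity>\<close> 20) = LPair (lfst: 'a) (lsnd: 'b)

instantiation linf_sum :: (real_normed_vector, real_normed_vector) real_normed_vector
begin

definition zero_linf_sum :: "'a \<oplus>\<^sub>\<infinity> 'b" where
  "zero_linf_sum = LPair 0 0"

definition plus_linf_sum :: "'a \<oplus>\<^sub>\<infinity> 'b \<Rightarrow> 'a \<oplus>\<^sub>\<infinity> 'b \<Rightarrow> 'a \<oplus>\<^sub>\<infinity> 'b" where
  "plus_linf_sum z w = LPair (lfst z + lfst w) (lsnd z + lsnd w)"

definition minus_linf_sum :: "'a \<oplus>\<^sub>\<infinity> 'b \<Rightarrow> 'a \<oplus>\<^sub>\<infinity> 'b \<Rightarrow> 'a \<oplus>\<^sub>\<infinity> 'b" where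
  "minus_linf_sum z w = LPair (lfst z - lfst w) (lsnd z - lsnd w)"

definition uminus_linf_sum :: "'a \<oplus>\<^sub>\<infinity> 'b \<Rightarrow> 'a \<oplus>\<^sub>\<infinity> 'b" where
  "uminus_linf_sum z = LPair (- lfst z) (- lsnd z)"

definition scaleR_linf_sum :: "real \<Rightarrow> 'a \<oplus>\<^sub>\<infinity> 'b \<Rightarrow> 'a \<oplus>\<^sub>\<infinity> 'b" where
  "scaleR_linf_sum r z = LPair (r *\<^sub>R lfst z) (r *\<^sub>R lsnd z)"

definition norm_linf_sum :: "'a \<oplus>\<^sub>\<infinity> 'b \<Rightarrow> real" where
  "norm_linf_sum z = max (norm (lfst z)) (norm (lsnd z))"

definition sgn_linf_sum :: "'a \<oplus>\<^sub>\<infinity> 'b \<Rightarrow> 'a \<oplus>\<^sub>\<infinity> 'b" where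
  "sgn_linf_sum z = inverse (norm z) *\<^sub>R z"

definition dist_linf_sum :: "'a \<oplus>\<^sub>\<infinity> 'b \<Rightarrow> 'a \<oplus>\<^sub>\<infinity> 'b \<Rightarrow> real" where
  "dist_linf_sum z w = norm (z - w)"

definition uniformity_linf_sum :: "(('a \<oplus>\<^sub>\<infinity> 'b) \<times> ('a \<oplus>\<^sub>\<infinity> 'b)) filter" where
  "uniformity_linf_sum = (INF e\<in>{0<..}. principal {(z, w). dist z w < e})"

definition open_linf_sum :: "('a \<oplus>\<^sub>\<infinity> 'b) set \<Rightarrow> bool" where
  "open_linf_sum U \<longleftrightarrow> (\<forall>z\<in>U. eventually (\<lambda>(z', w). z' = z \<longrightarrow> w \<in> U) uniformity)"

instance
proof
  fix x y z :: "'a \<oplus>\<^sub>\<infinity> 'b" and r s :: real and U :: "('a \<oplus>\<^sub>\<infinity> 'b) set"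
  note vec_defs = zero_linf_sum_def plus_linf_sum_def minus_linf_sum_def
    uminus_linf_sum_def scaleR_linf_sum_def
  show "x + y + z = x + (y + z)" "x + y = y + x" "0 + x = x" "- x + x = 0" "x - y = x + - y"
    "r *\<^sub>R (x + y) = r *\<^sub>R x + r *\<^sub>R y" "(r + s) *\<^sub>R x = r *\<^sub>R x + s *\<^sub>R x"
    "r *\<^sub>R s *\<^sub>R x = (r * s) *\<^sub>R x" "1 *\<^sub>R x = x"
    by (simp_all add: vec_defs algebra_simps)
  show "dist x y = norm (x - y)" by (rule dist_linf_sum_def)
  show "sgn x = inverse (norm x) *\<^sub>R x" by (rule sgn_linf_sum_def)
  show "uniformity = (INF e\<in>{0<..}. principal {(z :: 'a \<oplus>\<^sub>\<infinity> 'b, w). dist z w < e})"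
    by (rule uniformity_linf_sum_def)
  show "open U \<longleftrightarrow> (\<forall>z\<in>U. \<forall>\<^sub>F (z', w) in uniformity. z' = z \<longrightarrow> w \<in> U)"
    by (rule open_linf_sum_def)
  show "norm x = 0 \<longleftrightarrow> x = 0"
  proof -
    have "max (norm (lfst x)) (norm (lsnd x)) = 0 \<longleftrightarrow> lfst x = 0 \<and> lsnd x = 0"
      by (smt (verit) norm_eq_zero norm_ge_zero)
    then show ?thesis by (cases x) (simp add: norm_linf_sum_def vec_defs)
  qed
  have "norm (lfst x + lfst y) \<le> norm (lfst x) + norm (lfst y)"
    "norm (lsnd x + lsnd y) \<le> norm (lsnd x) + norm (lsnd y)"
    by (rule norm_triangle_ineq)+
  then show "norm (x + y) \<le> norm x + norm y"
    by (simp add: norm_linf_sum_def vec_defs max_def)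
  show "norm (r *\<^sub>R x) = \<bar>r\<bar> * norm x"
    by (simp add: norm_linf_sum_def vec_defs max_mult_distrib_left)
qed

end

lemma bounded_linear_lfst: "bounded_linear (lfst :: ('a::real_normed_vector \<oplus>\<^sub>\<infinity> 'b::real_normed_vector) \<Rightarrow> 'a)"
  by (rule bounded_linear_intro[where K = 1])
    (simp_all add: plus_linf_sum_def scaleR_linf_sum_def norm_linf_sum_def)

lemma bounded_linear_lsnd: "bounded_linear (lsnd :: ('a::real_normed_vector \<oplus>\<^sub>\<infinity> 'b::real_normed_vector) \<Rightarrow> 'b)"
  by (rule bounded_linear_intro[where K = 1])
    (simp_all add: plus_linf_sum_def scaleR_linf_sum_def norm_linf_sum_def)

instance linf_sum :: (banach, banach) banach
proof
  fix Z :: "nat \<Rightarrow> 'a \<oplus>\<^sub>\<infinity> 'b"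
  assume "Cauchy Z"
  then have "Cauchy (\<lambda>n. lfst (Z n))" "Cauchy (\<lambda>n. lsnd (Z n))"
    by (simp_all add: bounded_linear.Cauchy[OF bounded_linear_lfst]
        bounded_linear.Cauchy[OF bounded_linear_lsnd])
  then obtain a b where a: "(\<lambda>n. lfst (Z n)) \<longlonglongrightarrow> a" and b: "(\<lambda>n. lsnd (Z n)) \<longlonglongrightarrow> b"
    by (meson Cauchy_convergent convergent_def)
  have "Z \<longlonglongrightarrow> LPair a b"
  proof (rule tendstoI)
    fix e :: real
    assume "e > 0"
    then have "\<forall>\<^sub>F n in sequentially. dist (lfst (Z n)) a < e"
      "\<forall>\<^sub>F n in sequentially. dist (lsnd (Z n)) b < e"
      using a b by (blast dest: tendstoD)+
    then show "\<forall>\<^sub>F n in sequentially. dist (Z n) (LPair a b) < e"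
      by eventually_elim
        (simp add: dist_linf_sum_def norm_linf_sum_def minus_linf_sum_def dist_norm)
  qed
  then show "convergent Z" by (auto simp: convergent_def)
qed

end

theory Submission
  imports Defs
begin

text \<open>The dual of \<open>X \<oplus>\<^sub>\<infinity> Y\<close> is the \<open>\<ell>\<^sub>1\<close>-sum of the duals. If \<open>h = (f, g)\<close> determines a slice of
  diameter less than \<open>2\<close>, then \<open>f \<noteq> 0\<close>, since otherwise the slice contains a copy of the unit ball
  of \<open>X\<close>. Fixing \<open>y\<close> that almost norms \<open>g\<close>, the map \<open>x \<mapsto> (x, y)\<close> embeds a slice of \<open>f / \<parallel>f\<parallel>\<close>
  isometrically into the slice of \<open>h\<close>. Conversely, for slices of \<open>f\<close> and \<open>g\<close> of small diameter, a
  thin enough slice of \<open>(f / 2, g / 2)\<close> is contained in their product.\<close>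

text \<open>No absolute value is needed, since the unit ball is symmetric. If \<open>f\<close>
  stayed below \<open>norm f - \<delta>\<close> on the ball, testing normalised \<open>x\<close> and
  \<open>- x\<close> would make that number a bound for the operator norm.\<close>

lemma blinfun_almost_normed:
  fixes f :: "'a::real_normed_vector \<Rightarrow>\<^sub>L real"
  assumes "\<delta> > 0"
  obtains x where "norm x \<le> 1" and "blinfun_apply f x > norm f - \<delta>"
proof -
  have "\<exists>x. norm x \<le> 1 \<and> blinfun_apply f x > norm f - \<delta>"
  proof (rule ccontr)
    assume "\<nexists>x. norm x \<le> 1 \<and> blinfun_apply f x > norm f - \<delta>"
    then have le: "blinfun_apply f x \<le> norm f - \<delta>" if "norm x \<le> 1" for x
      using that by force
    have "norm f \<le> norm f - \<delta>"
    proof (rule norm_blinfun_bound)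
      show "0 \<le> norm f - \<delta>"
        using le[of 0] by simp
      show "norm (blinfun_apply f x) \<le> (norm f - \<delta>) * norm x" for x
      proof (cases "x = 0")
        case False
        have "blinfun_apply f (x /\<^sub>R norm x) \<le> norm f - \<delta>" "blinfun_apply f ((- x) /\<^sub>R norm x) \<le> norm f - \<delta>"
          using False by (intro le; simp)+
        with False show ?thesis
          by (auto simp: blinfun.scaleR_right blinfun.minus_right field_simps abs_le_iff)
      qed simp
    qed
    with assms show False by simp
  qed
  then show ?thesis
    using that by blast
qed

text \<open>\<open>diameter\<close> is a supremum of reals, which is guaranteed to dominate the
  distances only for a bounded set.\<close>

lemma bounded_ball_slice: "bounded (ball_slice f \<alpha>)"
  unfolding ball_slice_def by (rule bounded_subset[of "cball 0 1"]) auto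

lemma norm_diff_le_diameter_ball_slice:
  assumes "x \<in> ball_slice f \<alpha>" and "y \<in> ball_slice f \<alpha>"
  shows "norm (x - y) \<le> diameter (ball_slice f \<alpha>)"
  using diameter_bounded_bound[OF bounded_ball_slice assms] by (simp add: dist_norm)

lemma diameter_ball_slice_nonneg: "0 \<le> diameter (ball_slice f \<alpha>)"
  by (rule diameter_ge_0[OF bounded_ball_slice])

definition linf_functional ::
    "('a::real_normed_vector \<Rightarrow>\<^sub>L real) \<Rightarrow> ('b::real_normed_vector \<Rightarrow>\<^sub>L real) \<Rightarrow> ('a \<oplus>\<^sub>\<infinity> 'b) \<Rightarrow>\<^sub>L real" where
  "linf_functional f g = (f o\<^sub>L Blinfun lfst) + (g o\<^sub>L Blinfun lsnd)"

lemma linf_functional_apply [simp]: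
  "blinfun_apply (linf_functional f g) z = blinfun_apply f (lfst z) + blinfun_apply g (lsnd z)"
  by (simp add: linf_functional_def plus_blinfun.rep_eq bounded_linear_Blinfun_apply
      bounded_linear_lfst bounded_linear_lsnd)

text \<open>The components are the restrictions of \<open>h\<close> to the two coordinate subspaces,
  which together span the sum.\<close>

lemma linf_functional_exhaust:
  fixes h :: "('a::real_normed_vector \<oplus>\<^sub>\<infinity> 'b::real_normed_vector) \<Rightarrow>\<^sub>L real"
  obtains f g where "h = linf_functional f g"
proof
  have "bounded_linear (\<lambda>x. LPair x 0 :: 'a \<oplus>\<^sub>\<infinity> 'b)" "bounded_linear (\<lambda>y. LPair 0 y :: 'a \<oplus>\<^sub>\<infinity> 'b)"
    by (rule bounded_linear_intro[where K = 1];
        simp add: plus_linf_sum_def scaleR_linf_sum_def norm_linf_sum_def)+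
  note inject = this[THEN bounded_linear_Blinfun_apply]
  show "h = linf_functional (h o\<^sub>L Blinfun (\<lambda>x. LPair x 0)) (h o\<^sub>L Blinfun (\<lambda>y. LPair 0 y))"
  proof (rule blinfun_eqI)
    fix z :: "'a \<oplus>\<^sub>\<infinity> 'b"
    have "z = LPair (lfst z) 0 + LPair 0 (lsnd z)"
      by (simp add: plus_linf_sum_def)
    then have "blinfun_apply h z = blinfun_apply h (LPair (lfst z) 0) + blinfun_apply h (LPair 0 (lsnd z))"
      by (metis blinfun.add_right)
    also have "\<dots> = blinfun_apply (linf_functional (h o\<^sub>L Blinfun (\<lambda>x. LPair x 0)) (h o\<^sub>L Blinfun (\<lambda>y. LPair 0 y))) z"
      by (simp add: inject)
    finally show "blinfun_apply h z = \<dots>" .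
  qed
qed

text \<open>For the lower bound, the max norm lets the coordinates be chosen independently:
  near-maximisers of \<open>f\<close> and \<open>g\<close> in their unit balls form a point of the
  unit ball of the sum. Each loses at most \<open>\<delta> / 2\<close>.\<close>

lemma norm_linf_functional: "norm (linf_functional f g) = norm f + norm g"
proof (rule antisym)
  show "norm (linf_functional f g) \<le> norm f + norm g"
  proof (rule norm_blinfun_bound)
    fix z :: "'a \<oplus>\<^sub>\<infinity> 'b"
    have "norm (blinfun_apply f (lfst z) + blinfun_apply g (lsnd z)) \<le> norm f * norm (lfst z) + norm g * norm (lsnd z)"
      by (intro norm_triangle_mono norm_blinfun)
    also have "\<dots> \<le> norm f * norm z + norm g * norm z"
      by (intro add_mono mult_left_mono) (auto simp: norm_linf_sum_def)
    finally show "norm (blinfun_apply (linf_functional f g) z) \<le> (norm f + norm g) * norm z"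
      by (simp add: distrib_right)
  qed simp
next
  show "norm f + norm g \<le> norm (linf_functional f g)"
  proof (rule field_le_epsilon)
    fix \<delta> :: real
    assume "\<delta> > 0"
    then have "\<delta> / 2 > 0" by simp
    then obtain x where x: "norm x \<le> 1" "blinfun_apply f x > norm f - \<delta> / 2"
      by (rule blinfun_almost_normed)
    obtain y where y: "norm y \<le> 1" "blinfun_apply g y > norm g - \<delta> / 2"
      using \<open>\<delta> / 2 > 0\<close> by (rule blinfun_almost_normed)
    have "blinfun_apply (linf_functional f g) (LPair x y) \<le> norm (linf_functional f g) * norm (LPair x y)"
      using norm_blinfun[of "linf_functional f g" "LPair x y"] by (simp only: real_norm_def)
    also have "\<dots> \<le> norm (linf_functional f g) * 1"
      using x y by (intro mult_left_mono) (auto simp: norm_linf_sum_def)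
    finally show "norm f + norm g \<le> norm (linf_functional f g) + \<delta>"
      using x y by simp
  qed
qed

lemma BDP_linf_sum_left:
  assumes nontrivial: "(UNIV :: 'a::banach set) \<noteq> {0}"
    and BDP: "BDP TYPE('a \<oplus>\<^sub>\<infinity> 'b::banach)"
  shows "BDP TYPE('a)"
  unfolding BDP_def
proof (intro allI impI)
  fix \<epsilon> :: real
  assume "\<epsilon> > 0"
  \<comment> \<open>The cap at 2, the diameter of a nontrivial unit ball, serves to rule out
    \<open>f = 0\<close> below.\<close>
  then have "min \<epsilon> 2 > 0" by simp
  with BDP obtain h :: "('a \<oplus>\<^sub>\<infinity> 'b) \<Rightarrow>\<^sub>L real" and \<alpha>
    where "\<alpha> > 0" and "norm h = 1" and diam: "diameter (ball_slice h \<alpha>) < min \<epsilon> 2"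
    unfolding BDP_def by blast
  obtain f g where h: "h = linf_functional f g"
    by (rule linf_functional_exhaust)
  with \<open>norm h = 1\<close> have sum: "norm f + norm g = 1"
    by (simp add: norm_linf_functional)
  from \<open>\<alpha> > 0\<close> have "\<alpha> / 2 > 0" by simp
  then obtain y where y: "norm y \<le> 1" "blinfun_apply g y > norm g - \<alpha> / 2"
    by (rule blinfun_almost_normed)
  \<comment> \<open>The two defects of \<open>\<alpha> / 2\<close> add up to
    \<open>\<alpha>\<close>, because the norms of \<open>f\<close> and \<open>g\<close> sum to
    1.\<close>
  have mem: "LPair x y \<in> ball_slice h \<alpha>" if "norm x \<le> 1" "blinfun_apply f x > norm f - \<alpha> / 2" for x
    using that y sum by (simp add: ball_slice_def h norm_linf_sum_def)
  \<comment> \<open>The points \<open>LPair u y\<close> and \<open>LPair v y\<close> share their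
    second coordinate, so their distance is \<open>norm (u - v)\<close>.\<close>
  have dist: "norm (u - v) \<le> diameter (ball_slice h \<alpha>)"
    if "norm u \<le> 1" "blinfun_apply f u > norm f - \<alpha> / 2"
      "norm v \<le> 1" "blinfun_apply f v > norm f - \<alpha> / 2" for u v
    using norm_diff_le_diameter_ball_slice[OF mem mem] that
    by (simp add: norm_linf_sum_def minus_linf_sum_def)
  have "f \<noteq> 0"
  proof
    assume "f = 0"
    obtain u :: 'a where "u \<noteq> 0"
      using nontrivial by auto
    \<comment> \<open>For \<open>f = 0\<close> the condition on \<open>f\<close> reads
      \<open>0 > - \<alpha> / 2\<close>, so every point of the unit ball qualifies, in particular
      two antipodal unit vectors.\<close>
    have "norm (sgn u - - sgn u) \<le> diameter (ball_slice h \<alpha>)"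
      using \<open>f = 0\<close> \<open>u \<noteq> 0\<close> \<open>\<alpha> > 0\<close> by (intro dist) (simp_all add: norm_sgn)
    moreover have "norm (sgn u - - sgn u) = 2"
      using \<open>u \<noteq> 0\<close> by (simp add: norm_sgn flip: scaleR_2)
    ultimately show False
      using diam by simp
  qed
  \<comment> \<open>Dividing the threshold \<open>norm f - \<alpha> / 2\<close> by
    \<open>norm f\<close> gives \<open>1 - ?\<beta>\<close>.\<close>
  let ?F = "f /\<^sub>R norm f" and ?\<beta> = "\<alpha> / (2 * norm f)"
  have "diameter (ball_slice ?F ?\<beta>) \<le> diameter (ball_slice h \<alpha>)"
  proof (rule diameter_le)
    fix u v
    have slice: "norm x \<le> 1 \<and> blinfun_apply f x > norm f - \<alpha> / 2" if "x \<in> ball_slice ?F ?\<beta>" for x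
    proof -
      have "(norm f - \<alpha> / 2) / norm f = 1 - ?\<beta>"
        using \<open>f \<noteq> 0\<close> by (simp add: diff_divide_distrib)
      also have "\<dots> < blinfun_apply f x / norm f"
        using that
        by (simp only: ball_slice_def mem_Collect_eq blinfun.scaleR_left real_scaleR_def divide_inverse_commute)
      finally have "(norm f - \<alpha> / 2) / norm f < blinfun_apply f x / norm f" .
      moreover have "norm x \<le> 1"
        using that by (simp add: ball_slice_def)
      ultimately show ?thesis
        using \<open>f \<noteq> 0\<close> by (simp add: divide_less_cancel)
    qed
    assume "u \<in> ball_slice ?F ?\<beta>" "v \<in> ball_slice ?F ?\<beta>"
    then show "norm (u - v) \<le> diameter (ball_slice h \<alpha>)"
      using slice by (intro dist) auto
  qed (simp add: diameter_ball_slice_nonneg)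
  with diam \<open>\<alpha> > 0\<close> \<open>f \<noteq> 0\<close>
  show "\<exists>f :: 'a \<Rightarrow>\<^sub>L real. \<exists>\<alpha>>0. norm f = 1 \<and> diameter (ball_slice f \<alpha>) < \<epsilon>"
    by (intro exI[of _ ?F] exI[of _ ?\<beta>]) simp
qed

text \<open>Exchanging the coordinates is an isometry. This transfers the result on the first
  summand to the second.\<close>

lemma BDP_linf_sum_swap:
  assumes "BDP TYPE('a::banach \<oplus>\<^sub>\<infinity> 'b::banach)"
  shows "BDP TYPE('b \<oplus>\<^sub>\<infinity> 'a)"
  unfolding BDP_def
proof (intro allI impI)
  fix \<epsilon> :: real
  assume "\<epsilon> > 0"
  with assms obtain h :: "('a \<oplus>\<^sub>\<infinity> 'b) \<Rightarrow>\<^sub>L real" and \<alpha>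
    where "\<alpha> > 0" and "norm h = 1" and diam: "diameter (ball_slice h \<alpha>) < \<epsilon>"
    unfolding BDP_def by blast
  obtain f g where h: "h = linf_functional f g"
    by (rule linf_functional_exhaust)
  let ?h = "linf_functional g f"
  have "diameter (ball_slice ?h \<alpha>) \<le> diameter (ball_slice h \<alpha>)"
  proof (rule diameter_le)
    fix z w
    have slice: "LPair (lsnd z) (lfst z) \<in> ball_slice h \<alpha>" if "z \<in> ball_slice ?h \<alpha>" for z
      using that by (simp add: ball_slice_def h norm_linf_sum_def)
    assume "z \<in> ball_slice ?h \<alpha>" "w \<in> ball_slice ?h \<alpha>"
    from norm_diff_le_diameter_ball_slice[OF slice slice, OF this]
    show "norm (z - w) \<le> diameter (ball_slice h \<alpha>)"
      by (simp add: norm_linf_sum_def minus_linf_sum_def max.commute)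
  qed (simp add: diameter_ball_slice_nonneg)
  moreover have "norm ?h = 1"
    using \<open>norm h = 1\<close> by (simp add: h norm_linf_functional)
  ultimately show "\<exists>f :: ('b \<oplus>\<^sub>\<infinity> 'a) \<Rightarrow>\<^sub>L real. \<exists>\<alpha>>0. norm f = 1 \<and> diameter (ball_slice f \<alpha>) < \<epsilon>"
    using diam \<open>\<alpha> > 0\<close> by (meson order_le_less_trans)
qed

lemma BDP_linf_sum:
  assumes "BDP TYPE('a::banach)" and "BDP TYPE('b::banach)"
  shows "BDP TYPE('a \<oplus>\<^sub>\<infinity> 'b)"
  unfolding BDP_def
proof (intro allI impI)
  fix \<epsilon> :: real
  assume "\<epsilon> > 0"
  from assms(1) \<open>\<epsilon> > 0\<close> obtain f :: "'a \<Rightarrow>\<^sub>L real" and \<alpha>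
    where f: "\<alpha> > 0" "norm f = 1" "diameter (ball_slice f \<alpha>) < \<epsilon>"
    unfolding BDP_def by blast
  from assms(2) \<open>\<epsilon> > 0\<close> obtain g :: "'b \<Rightarrow>\<^sub>L real" and \<beta>
    where g: "\<beta> > 0" "norm g = 1" "diameter (ball_slice g \<beta>) < \<epsilon>"
    unfolding BDP_def by blast
  \<comment> \<open>The weights 1/2 give \<open>?h\<close> norm 1. Doubling its slice condition
    yields \<open>f (lfst z) + g (lsnd z) > 2 - min \<alpha> \<beta>\<close>.\<close>
  let ?h = "linf_functional (f /\<^sub>R 2) (g /\<^sub>R 2)" and ?\<gamma> = "min \<alpha> \<beta> / 2"
  let ?d = "max (diameter (ball_slice f \<alpha>)) (diameter (ball_slice g \<beta>))"
  have "diameter (ball_slice ?h ?\<gamma>) \<le> ?d"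
  proof (rule diameter_le)
    fix z w
    have slice: "lfst z \<in> ball_slice f \<alpha> \<and> lsnd z \<in> ball_slice g \<beta>" if "z \<in> ball_slice ?h ?\<gamma>" for z
    proof -
      have z: "norm (lfst z) \<le> 1" "norm (lsnd z) \<le> 1"
        "blinfun_apply f (lfst z) + blinfun_apply g (lsnd z) > 2 - min \<alpha> \<beta>"
        using that by (auto simp: ball_slice_def norm_linf_sum_def scaleR_blinfun.rep_eq)
      \<comment> \<open>Since neither summand exceeds 1, each must be greater than
        \<open>1 - min \<alpha> \<beta>\<close>, which puts both coordinates in their
        slices.\<close>
      have "blinfun_apply f (lfst z) \<le> 1" "blinfun_apply g (lsnd z) \<le> 1"
        using z f g norm_blinfun[of f "lfst z"] norm_blinfun[of g "lsnd z"] by auto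
      with z show ?thesis
        by (auto simp: ball_slice_def)
    qed
    assume "z \<in> ball_slice ?h ?\<gamma>" "w \<in> ball_slice ?h ?\<gamma>"
    then have "norm (lfst z - lfst w) \<le> diameter (ball_slice f \<alpha>)"
      "norm (lsnd z - lsnd w) \<le> diameter (ball_slice g \<beta>)"
      using slice norm_diff_le_diameter_ball_slice by blast+
    then show "norm (z - w) \<le> ?d"
      by (auto simp: norm_linf_sum_def minus_linf_sum_def)
  qed (simp add: le_max_iff_disj diameter_ball_slice_nonneg)
  moreover have "norm ?h = 1"
    using f g by (simp add: norm_linf_functional)
  ultimately show "\<exists>f :: ('a \<oplus>\<^sub>\<infinity> 'b) \<Rightarrow>\<^sub>L real. \<exists>\<alpha>>0. norm f = 1 \<and> diameter (ball_slice f \<alpha>) < \<epsilon>"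
    using f g by (intro exI[of _ ?h] exI[of _ ?\<gamma>]) auto
qed

theorem proposition2p7:
  assumes "(UNIV :: 'a::banach set) \<noteq> {0}"
    and "(UNIV :: 'b::banach set) \<noteq> {0}"
  shows "BDP TYPE('a \<oplus>\<^sub>\<infinity> 'b) \<longleftrightarrow> BDP TYPE('a) \<and> BDP TYPE('b)"
proof (intro iffI conjI)
  assume BDP: "BDP TYPE('a \<oplus>\<^sub>\<infinity> 'b)"
  show "BDP TYPE('a)"
    by (rule BDP_linf_sum_left[OF assms(1) BDP])
  show "BDP TYPE('b)"
    by (rule BDP_linf_sum_left[OF assms(2) BDP_linf_sum_swap[OF BDP]])
next
  assume "BDP TYPE('a) \<and> BDP TYPE('b)"
  then show "BDP TYPE('a \<oplus>\<^sub>\<infinity> 'b)"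
    by (intro BDP_linf_sum) simp_all
qed

end
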